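(* Let $G$ be a graph. The value of the unrooted-$P_3$-game on $G$ with Maximizer responding (and Minimizer initiating) is $\mu(G)$.
   Context: Graphs are finite, simple and undirected. $P_3$ is the path on three vertices; copies of $P_3$ in a graph are subgraphs, not necessarily induced. A $P_3$-packing of $G$ is a collection of vertex-disjoint copies of $P_3$ in $G$, and $\mu(G)$ is the maximum size (number of copies) of a $P_3$-packing of $G$. The unrooted-$P_3$-game on $G$ is played by two players, Maximizer and Minimizer; throughout the game one of them is the initiator and the other is the responder. In each round, the initiator chooses a vertex $v$ of the current graph that lies in at least one copy of $P_3$ in the current graph; the responder then chooses one copy of $P_3$ in the current graph containing $v$ (in any position); the three vertices of that copy are removed, and the next round is played on the subgraph induced by the remaining vertices. The game ends when the remaining graph contains no copy of $P_3$. Maximizer tries to maximize, and Minimizer tries to minimize, the number of copies of $P_3$ taken. The value of the game is the number of copies taken under optimal play by both players. *)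

theory Defs
  imports "Graph_Theory.Digraph_Component"
begin

text \<open>
  Finite simple undirected graphs are instances of the locale \<^locale>\<open>graph\<close>: finite digraphs
  without loops and parallel arcs whose adjacency relation is symmetric, so that an undirected
  edge is a pair of opposite arcs.
\<close>

definition is_P3 :: "('a, 'b) pre_digraph \<Rightarrow> bool" where
  "is_P3 H \<longleftrightarrow> (\<exists>x y z. distinct [x, y, z] \<and> verts H = {x, y, z} \<and>
     arcs_ends H = {(x, y), (y, x), (y, z), (z, y)})"

text \<open>
  Copies are subgraphs, not vertex sets: a triangle contains three of them.
\<close>

definition P3_copies :: "('a, 'b) pre_digraph \<Rightarrow> ('a, 'b) pre_digraph set" where
  "P3_copies G = {H. subgraph H G \<and> is_P3 H}"

definition P3_packing :: "('a, 'b) pre_digraph \<Rightarrow> ('a, 'b) pre_digraph set \<Rightarrow> bool" where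
  "P3_packing G P \<longleftrightarrow> P \<subseteq> P3_copies G \<and> pairwise (\<lambda>H H'. disjnt (verts H) (verts H')) P"

definition P3_packing_number :: "('a, 'b) pre_digraph \<Rightarrow> nat" where
  "P3_packing_number G = Max {card P | P. P3_packing G P}"

lemma finite_P3_copies:
  assumes "graph G"
  shows "finite (P3_copies G)"
proof -
  interpret graph G by fact
  let ?f = "\<lambda>(V, A). \<lparr>verts = V, arcs = A, tail = tail G, head = head G\<rparr>"
  have "P3_copies G \<subseteq> ?f ` (Pow (verts G) \<times> Pow (arcs G))"
  proof
    fix H assume "H \<in> P3_copies G"
    then have "verts H \<subseteq> verts G" "arcs H \<subseteq> arcs G" "tail H = tail G" "head H = head G"
      by (auto simp: P3_copies_def subgraph_def compatible_def)
    then have "H = ?f (verts H, arcs H)" "(verts H, arcs H) \<in> Pow (verts G) \<times> Pow (arcs G)"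
      by (auto intro: pre_digraph.equality)
    then show "H \<in> ?f ` (Pow (verts G) \<times> Pow (arcs G))"
      by (rule image_eqI)
  qed
  then show ?thesis
    by (rule finite_subset) (simp add: finite_verts finite_arcs)
qed

lemma P3_packing_sizes:
  assumes "graph G"
  shows "finite {card P | P. P3_packing G P}" "{card P | P. P3_packing G P} \<noteq> {}"
proof -
  have "{card P | P. P3_packing G P} \<subseteq> card ` Pow (P3_copies G)"
    by (auto simp: P3_packing_def)
  then show "finite {card P | P. P3_packing G P}"
    by (rule finite_subset) (simp add: finite_P3_copies[OF assms])
  have "P3_packing G {}"
    by (simp add: P3_packing_def)
  then show "{card P | P. P3_packing G P} \<noteq> {}"
    by blast
qed

datatype player = Maximizer | Minimizer

primrec opponent :: "player \<Rightarrow> player" where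
  "opponent Maximizer = Minimizer"
| "opponent Minimizer = Maximizer"

primrec optimum :: "player \<Rightarrow> nat set \<Rightarrow> nat" where
  "optimum Maximizer = Max"
| "optimum Minimizer = Min"

text \<open>
  The value of the unrooted-P3-game in which player \<open>r\<close> is the responder throughout, by
  backward induction: \<open>opponent r\<close> picks a vertex \<open>v\<close> lying in some copy, then \<open>r\<close> picks a copy
  \<open>H\<close> containing \<open>v\<close>. The finiteness test only serves termination; on graphs it disappears and
  all optima are taken over finite nonempty sets (see the lemmas below).
\<close>

function game_value :: "player \<Rightarrow> ('a, 'b) pre_digraph \<Rightarrow> nat" where
  "game_value r G =
    (if finite (verts G) \<and> P3_copies G \<noteq> {}
     then optimum (opponent r)
       ((\<lambda>v. optimum r
          ((\<lambda>H. Suc (game_value r (G \<restriction> (verts G - verts H)))) ` {H \<in> P3_copies G. v \<in> verts H}))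
        ` (\<Union>H \<in> P3_copies G. verts H))
     else 0)"
  by pat_completeness auto
termination
proof (relation "measure (\<lambda>(r, G). card (verts G))", goal_cases)
  case (2 r G v H)
  then have "verts H \<subseteq> verts G" "verts H \<noteq> {}"
    by (auto simp: P3_copies_def is_P3_def subgraph_def)
  then have "verts G - verts H \<subset> verts G"
    by blast
  then show ?case
    using 2 by (auto intro: psubset_card_mono)
qed simp

declare game_value.simps [simp del]

lemma game_value_eq:
  assumes "graph G"
  shows "game_value r G =
    (if P3_copies G = {} then 0
     else optimum (opponent r)
       ((\<lambda>v. optimum r
          ((\<lambda>H. Suc (game_value r (G \<restriction> (verts G - verts H)))) ` {H \<in> P3_copies G. v \<in> verts H}))
        ` (\<Union>H \<in> P3_copies G. verts H)))"
proof -
  interpret graph G by fact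
  show ?thesis
    by (subst game_value.simps) (simp add: finite_verts)
qed

lemma game_moves:
  assumes "graph G"
  shows "finite (\<Union>H \<in> P3_copies G. verts H)"
    and "P3_copies G \<noteq> {} \<Longrightarrow> (\<Union>H \<in> P3_copies G. verts H) \<noteq> {}"
    and "finite {H \<in> P3_copies G. v \<in> verts H}"
    and "v \<in> (\<Union>H \<in> P3_copies G. verts H) \<Longrightarrow> {H \<in> P3_copies G. v \<in> verts H} \<noteq> {}"
proof -
  have *: "finite (verts H)" "verts H \<noteq> {}" if "H \<in> P3_copies G" for H
    using that by (auto simp: P3_copies_def is_P3_def)
  note fin = finite_P3_copies[OF assms]
  show "finite (\<Union>H \<in> P3_copies G. verts H)"
    using fin * by simp
  show "P3_copies G \<noteq> {} \<Longrightarrow> (\<Union>H \<in> P3_copies G. verts H) \<noteq> {}"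
    using * by auto
  show "finite {H \<in> P3_copies G. v \<in> verts H}"
    using fin by simp
  show "v \<in> (\<Union>H \<in> P3_copies G. verts H) \<Longrightarrow> {H \<in> P3_copies G. v \<in> verts H} \<noteq> {}"
    by auto
qed

lemma graph_induce_subgraph:
  assumes "graph G" "S \<subseteq> verts G"
  shows "graph (G \<restriction> S)"
proof -
  interpret graph G by fact
  interpret ind: wf_digraph "G \<restriction> S" by (rule wellformed_induce_subgraph)
  show ?thesis
  proof unfold_locales
    show "finite (verts (G \<restriction> S))" "finite (arcs (G \<restriction> S))"
      using assms(2) finite_verts by (auto intro: finite_subset)
    show "\<And>e. e \<in> arcs (G \<restriction> S) \<Longrightarrow> tail (G \<restriction> S) e \<noteq> head (G \<restriction> S) e"
      using no_loops by auto
    show "\<And>e1 e2. e1 \<in> arcs (G \<restriction> S) \<Longrightarrow> e2 \<in> arcs (G \<restriction> S) \<Longrightarrow>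
        arc_to_ends (G \<restriction> S) e1 = arc_to_ends (G \<restriction> S) e2 \<Longrightarrow> e1 = e2"
      using no_multi_arcs by auto
    show "symmetric (G \<restriction> S)"
    proof -
      have "arcs_ends (G \<restriction> S) = arcs_ends G \<inter> S \<times> S"
        by (auto simp: arcs_ends_conv)
      then show ?thesis
        using sym_arcs by (auto simp: symmetric_def sym_def)
    qed
  qed
qed

end

theory Submission
  imports Defs
begin

text \<open>
  Whatever vertex \<open>v\<close> the initiator picks, the responder can answer with a copy that lowers the
  packing number by exactly one. No copy lowers it by less, since a packing of what remains extends
  by the copy just removed. For the converse fix a maximum packing \<open>P\<close>; it suffices to find a copy
  through \<open>v\<close> that meets at most one member of \<open>P\<close>, because the others then survive.

  If \<open>P\<close> covers \<open>v\<close>, the member covering it will do. Otherwise take a neighbour \<open>x\<close> of \<open>v\<close> inside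
  some copy through \<open>v\<close>. If a member \<open>A\<close> of \<open>P\<close> covers \<open>x\<close>, then \<open>x\<close> has a neighbour \<open>a\<close> in \<open>A\<close>, and
  the path \<open>v x a\<close> meets only \<open>A\<close>. If \<open>x\<close> is uncovered too, the original copy has only one vertex
  left at which it can meet \<open>P\<close>. This is \<open>copy_meeting_at_most_one\<close>; the theorem follows by
  induction on the number of vertices, as all moves of the initiator are equally good.
\<close>

section \<open>Copies of the path on three vertices\<close>

lemma P3_copy_of_path:
  assumes "graph G" "x \<rightarrow>\<^bsub>G\<^esub> y" "y \<rightarrow>\<^bsub>G\<^esub> z" "x \<noteq> z"
  obtains H where "H \<in> P3_copies G" "verts H = {x, y, z}"
proof -
  interpret graph G by fact
  let ?E = "{(x, y), (y, x), (y, z), (z, y)}"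
  let ?H = "\<lparr>verts = {x, y, z}, arcs = {e \<in> arcs G. arc_to_ends G e \<in> ?E},
    tail = tail G, head = head G\<rparr>"
  have sym: "y \<rightarrow>\<^bsub>G\<^esub> x" "z \<rightarrow>\<^bsub>G\<^esub> y"
    using assms graph_symmetric by blast+
  have distinct: "distinct [x, y, z]"
    using assms(2-4) adj_not_same[of x] adj_not_same[of y] by auto
  have "?E \<subseteq> arcs_ends G"
    using assms sym by auto
  moreover have "arcs_ends ?H = arcs_ends G \<inter> ?E"
    by (auto simp: arcs_ends_def arc_to_ends_def)
  ultimately have "arcs_ends ?H = ?E"
    by blast
  then have "is_P3 ?H"
    unfolding is_P3_def using distinct by (intro exI[of _ x] exI[of _ y] exI[of _ z]) simp
  moreover have "subgraph ?H G"
  proof (rule subgraphI)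
    show "verts ?H \<subseteq> verts G"
      using assms(2,3) adj_in_verts by simp
    show "wf_digraph ?H"
      by unfold_locales (auto simp: arc_to_ends_def)
  qed (auto simp: compatible_def wf_digraph_axioms)
  ultimately show thesis
    using that[of ?H] by (simp add: P3_copies_def)
qed

lemma P3_copy_neighbour:
  assumes "H \<in> P3_copies G" "v \<in> verts H"
  obtains x w where "verts H = {v, x, w}" "v \<rightarrow>\<^bsub>G\<^esub> x"
proof -
  obtain a b c where "verts H = {a, b, c}"
    and ends: "arcs_ends H = {(a, b), (b, a), (b, c), (c, b)}"
    using assms by (auto simp: P3_copies_def is_P3_def)
  moreover have "arcs_ends H \<subseteq> arcs_ends G"
    using assms by (auto simp: P3_copies_def subgraph_def compatible_def arcs_ends_def arc_to_ends_def)
  ultimately show thesis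
    using that[of b c] that[of a c] that[of b a] assms by auto
qed

lemma P3_copies_induce_subgraph:
  assumes "graph G" "S \<subseteq> verts G"
  shows "P3_copies (G \<restriction> S) = {H \<in> P3_copies G. verts H \<subseteq> S}"
proof -
  interpret graph G by fact
  have wf: "wf_digraph (G \<restriction> S)"
    by (rule wellformed_induce_subgraph)
  have "subgraph H (G \<restriction> S) \<longleftrightarrow> subgraph H G \<and> verts H \<subseteq> S" for H
  proof
    assume "subgraph H (G \<restriction> S)"
    then show "subgraph H G \<and> verts H \<subseteq> S"
      using assms wf_digraph_axioms by (auto simp: subgraph_def compatible_def)
  next
    assume sub: "subgraph H G \<and> verts H \<subseteq> S"
    then have compat: "tail H = tail G" "head H = head G"
      by (simp_all add: subgraph_def compatible_def)
    have "arcs H \<subseteq> arcs (G \<restriction> S)"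
    proof
      fix e assume e: "e \<in> arcs H"
      have "wf_digraph H"
        using sub by (simp add: subgraph_def)
      then have "tail H e \<in> verts H" "head H e \<in> verts H"
        using e by (auto simp: wf_digraph_def)
      with e sub show "e \<in> arcs (G \<restriction> S)"
        by (auto simp: compat subgraph_def)
    qed
    with sub wf compat show "subgraph H (G \<restriction> S)"
      by (simp add: subgraph_def compatible_def)
  qed
  then show ?thesis
    by (auto simp: P3_copies_def)
qed

section \<open>Packings after the removal of a copy\<close>

lemma P3_packing_remove_copy:
  assumes "graph G" "H \<in> P3_copies G"
  shows "P3_packing (G \<restriction> (verts G - verts H)) P \<longleftrightarrow>
    P3_packing G P \<and> (\<forall>B \<in> P. disjnt (verts B) (verts H))"
proof -
  have "verts B \<subseteq> verts G" if "B \<in> P3_copies G" for B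
    using that by (auto simp: P3_copies_def subgraph_def)
  then have "P3_copies (G \<restriction> (verts G - verts H)) = {B \<in> P3_copies G. disjnt (verts B) (verts H)}"
    by (auto simp: P3_copies_induce_subgraph[OF assms(1)] disjnt_def)
  then show ?thesis
    by (auto simp: P3_packing_def)
qed

lemma card_le_P3_packing_number:
  assumes "graph G" "P3_packing G P"
  shows "card P \<le> P3_packing_number G"
  unfolding P3_packing_number_def
  using assms by (intro Max_ge P3_packing_sizes) auto

lemma maximum_P3_packing:
  assumes "graph G"
  obtains P where "P3_packing G P" "card P = P3_packing_number G"
  using Max_in[OF P3_packing_sizes[OF assms]] unfolding P3_packing_number_def by auto

lemma finite_P3_packing:
  assumes "graph G" "P3_packing G P"
  shows "finite P"
  using assms finite_P3_copies finite_subset unfolding P3_packing_def by metis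

text \<open>
  The removed copy extends any packing of the remaining graph.
\<close>

lemma Suc_P3_packing_number_remove_le:
  assumes "graph G" "H \<in> P3_copies G"
  shows "Suc (P3_packing_number (G \<restriction> (verts G - verts H))) \<le> P3_packing_number G"
proof -
  have graph: "graph (G \<restriction> (verts G - verts H))"
    by (rule graph_induce_subgraph[OF assms(1)]) blast
  obtain P where P: "P3_packing (G \<restriction> (verts G - verts H)) P"
    "card P = P3_packing_number (G \<restriction> (verts G - verts H))"
    using maximum_P3_packing[OF graph] .
  have disj: "P3_packing G P" "\<forall>B \<in> P. disjnt (verts B) (verts H)"
    using P(1) by (simp_all add: P3_packing_remove_copy[OF assms])
  have "verts H \<noteq> {}"
    using assms by (auto simp: P3_copies_def is_P3_def)
  with disj have "H \<notin> P"
    by (auto simp: disjnt_def)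
  moreover have "P3_packing G (insert H P)"
    using disj assms(2) by (auto simp: P3_packing_def pairwise_insert intro: disjnt_sym)
  ultimately show ?thesis
    using card_le_P3_packing_number[OF assms(1), of "insert H P"] P(2)
      finite_P3_packing[OF graph P(1)]
    by simp
qed

text \<open>
  Conversely, if the removed copy meets no member of a packing other than \<open>A\<close>, the others survive.
\<close>

lemma card_P3_packing_le_Suc_remove:
  assumes "graph G" "H \<in> P3_copies G" "P3_packing G P"
    and "\<And>B. B \<in> P \<Longrightarrow> B \<noteq> A \<Longrightarrow> disjnt (verts B) (verts H)"
  shows "card P \<le> Suc (P3_packing_number (G \<restriction> (verts G - verts H)))"
proof -
  have "P3_packing G (P - {A})"
    using assms(3) by (auto simp: P3_packing_def pairwise_def)
  then have "P3_packing (G \<restriction> (verts G - verts H)) (P - {A})"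
    using assms(4) by (simp add: P3_packing_remove_copy[OF assms(1,2)])
  then have "card (P - {A}) \<le> P3_packing_number (G \<restriction> (verts G - verts H))"
    using graph_induce_subgraph[OF assms(1)] by (intro card_le_P3_packing_number) auto
  moreover have "card P \<le> Suc (card (P - {A}))"
    using card_Suc_Diff1[OF finite_P3_packing[OF assms(1,3)], of A] by (cases "A \<in> P") auto
  ultimately show ?thesis
    by simp
qed

section \<open>The responder can always keep up with a maximum packing\<close>

text \<open>
  The responder's strategy. A member of the packing that covers \<open>v\<close>, or else one that covers a
  neighbour of \<open>v\<close>, can be traded for a copy through \<open>v\<close>; if there is neither, the given copy
  through \<open>v\<close> has two uncovered vertices.
\<close>

lemma copy_meeting_at_most_one:
  assumes "graph G" "P3_packing G P" "H \<in> P3_copies G" "v \<in> verts H"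
  obtains K A where "K \<in> P3_copies G" "v \<in> verts K"
    "\<And>B. B \<in> P \<Longrightarrow> B \<noteq> A \<Longrightarrow> disjnt (verts B) (verts K)"
proof -
  have copy: "A \<in> P3_copies G" if "A \<in> P" for A
    using assms(2) that by (auto simp: P3_packing_def)
  have disj: "u \<notin> verts B" if "A \<in> P" "B \<in> P" "B \<noteq> A" "u \<in> verts A" for A B u
    using assms(2) that by (auto simp: P3_packing_def pairwise_def disjnt_iff)
  obtain x w where H: "verts H = {v, x, w}" and vx: "v \<rightarrow>\<^bsub>G\<^esub> x"
    using P3_copy_neighbour[OF assms(3,4)] .
  \<comment> \<open>the member covering \<open>w\<close>, or anything at all if \<open>w\<close> is uncovered\<close>
  obtain W where W: "w \<notin> verts B" if "B \<in> P" "B \<noteq> W" for B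
    using disj by blast
  consider (v) A where "A \<in> P" "v \<in> verts A"
    | (x) A where "A \<in> P" "x \<in> verts A" "\<forall>B \<in> P. v \<notin> verts B"
    | (w) "\<forall>B \<in> P. v \<notin> verts B" "\<forall>B \<in> P. x \<notin> verts B"
    by blast
  then show thesis
  proof cases
    case v
    show ?thesis
    proof (rule that)
      show "A \<in> P3_copies G" "v \<in> verts A"
        using v copy by blast+
      show "disjnt (verts B) (verts A)" if "B \<in> P" "B \<noteq> A" for B
        unfolding disjnt_iff using disj[OF v(1) that] by blast
    qed
  next
    case x
    obtain a b where a: "verts A = {x, a, b}" "x \<rightarrow>\<^bsub>G\<^esub> a"
      using P3_copy_neighbour[OF copy[OF x(1)] x(2)] .
    with x have "v \<noteq> a"
      by blast
    then obtain K where K: "K \<in> P3_copies G" "verts K = {v, x, a}"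
      using P3_copy_of_path[OF assms(1) vx a(2)] by blast
    show ?thesis
    proof (rule that)
      show "K \<in> P3_copies G" "v \<in> verts K"
        using K by blast+
      show "disjnt (verts B) (verts K)" if "B \<in> P" "B \<noteq> A" for B
        unfolding disjnt_iff K(2) using disj[OF x(1) that] a(1) x(3) that(1) by blast
    qed
  next
    case w
    show ?thesis
    proof (rule that)
      show "H \<in> P3_copies G" "v \<in> verts H"
        by (fact assms)+
      show "disjnt (verts B) (verts H)" if "B \<in> P" "B \<noteq> W" for B
        unfolding disjnt_iff H using w W that by blast
    qed
  qed
qed

lemma optimum_constant:
  assumes "A \<noteq> {}" "\<And>x. x \<in> A \<Longrightarrow> f x = c"
  shows "optimum p (f ` A) = c"
proof -
  have "f ` A = {c}"
    using assms by auto
  then show ?thesis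
    by (cases p) auto
qed

lemma Max_Suc_P3_packing_number_remove:
  assumes "graph G" "v \<in> (\<Union>H \<in> P3_copies G. verts H)"
  shows "Max ((\<lambda>H. Suc (P3_packing_number (G \<restriction> (verts G - verts H)))) `
    {H \<in> P3_copies G. v \<in> verts H}) = P3_packing_number G"
proof (rule antisym)
  let ?C = "{H \<in> P3_copies G. v \<in> verts H}"
  let ?f = "\<lambda>H. Suc (P3_packing_number (G \<restriction> (verts G - verts H)))"
  have fin: "finite (?f ` ?C)" "?f ` ?C \<noteq> {}"
    using game_moves(3,4)[OF assms(1)] assms(2) by blast+
  show "Max (?f ` ?C) \<le> P3_packing_number G"
    using fin Suc_P3_packing_number_remove_le[OF assms(1)] by (subst Max_le_iff) auto
  obtain P where P: "P3_packing G P" "card P = P3_packing_number G"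
    using maximum_P3_packing[OF assms(1)] .
  obtain H where "H \<in> P3_copies G" "v \<in> verts H"
    using assms(2) by blast
  then obtain K A where K: "K \<in> P3_copies G" "v \<in> verts K"
    "\<And>B. B \<in> P \<Longrightarrow> B \<noteq> A \<Longrightarrow> disjnt (verts B) (verts K)"
    using copy_meeting_at_most_one[OF assms(1) P(1)] by metis
  have "P3_packing_number G \<le> ?f K"
    using card_P3_packing_le_Suc_remove[OF assms(1) K(1) P(1) K(3)] P(2) by simp
  also have "\<dots> \<le> Max (?f ` ?C)"
    using fin(1) K by (intro Max_ge) auto
  finally show "P3_packing_number G \<le> Max (?f ` ?C)" .
qed

theorem theorem19:
  fixes G :: "('a, 'b) pre_digraph"
  assumes "graph G"
  shows "game_value Maximizer G = P3_packing_number G"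
  using assms
proof (induction "card (verts G)" arbitrary: G rule: less_induct)
  case less
  note G = \<open>graph G\<close>
  show ?case
  proof (cases "P3_copies G = {}")
    case True
    then have "{card P | P. P3_packing G P} = {0}"
      by (auto simp: P3_packing_def)
    then show ?thesis
      using True by (simp add: game_value_eq[OF G] P3_packing_number_def)
  next
    case False
    have IH: "game_value Maximizer (G \<restriction> (verts G - verts H)) =
        P3_packing_number (G \<restriction> (verts G - verts H))" if "H \<in> P3_copies G" for H
    proof (rule less.hyps)
      interpret graph G by (rule G)
      have "verts H \<subseteq> verts G" "verts H \<noteq> {}"
        using that by (auto simp: P3_copies_def is_P3_def subgraph_def)
      then show "card (verts (G \<restriction> (verts G - verts H))) < card (verts G)"
        by (auto intro!: psubset_card_mono)
      show "graph (G \<restriction> (verts G - verts H))"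
        by (rule graph_induce_subgraph[OF G]) blast
    qed
    have "optimum Maximizer
        ((\<lambda>H. Suc (game_value Maximizer (G \<restriction> (verts G - verts H)))) `
          {H \<in> P3_copies G. v \<in> verts H}) = P3_packing_number G"
      if "v \<in> (\<Union>H \<in> P3_copies G. verts H)" for v
    proof -
      have "(\<lambda>H. Suc (game_value Maximizer (G \<restriction> (verts G - verts H)))) `
            {H \<in> P3_copies G. v \<in> verts H} =
          (\<lambda>H. Suc (P3_packing_number (G \<restriction> (verts G - verts H)))) `
            {H \<in> P3_copies G. v \<in> verts H}"
        using IH by (intro image_cong) auto
      then show ?thesis
        using Max_Suc_P3_packing_number_remove[OF G that] by simp
    qed
    then show ?thesis
      unfolding game_value_eq[OF G] if_not_P[OF False]
      by (rule optimum_constant[OF game_moves(2)[OF G False]])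
  qed
qed

end
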